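(* Let $d\ge 2$, $N\ge 2d$, $1\le i\le d-1$, $0<h<1$, $M>0$. Let $F=\sum_{j=1}^d a_j\delta(x-x_j)\in\mathcal P_d$ form an $(i,h,M)$-cluster, and assume that $x_i-x_{i-1}\ge 3h$ (if $i\ge 2$) and $x_{i+2}-x_{i+1}\ge 3h$ (if $i\le d-2$). Put $\kappa=\frac{x_i+x_{i+1}}{2}$ and $C(F)=18M(1+|\kappa|)^N$. Then for each $\epsilon\ge C(F)h^3$ the worst case reconstruction error in the nodes of $F$ satisfies $\rho^x_\epsilon(F)\ge\frac12h$.
   Context: Signals: $\mathcal P_d=\{(a,x)=(a_1,\dots,a_d,x_1,\dots,x_d)\in\mathbb R^{2d}: x_1<x_2<\dots<x_d\}$. A point $(a,x)\in\mathcal P_d$ is identified with the spike-train signal $F(x)=\sum_{j=1}^d a_j\delta(x-x_j)$; the $a_j$ are its amplitudes (any real numbers) and the $x_j$ its nodes. Moments: $m_k(F)=\sum_{j=1}^d a_jx_j^k$, $k=0,1,2,\dots$. Error set: for a fixed number $N\ge 2d$ of moments and $\epsilon>0$, $E_\epsilon(F)=\{F'\in\mathcal P_d: |m_k(F')-m_k(F)|\le\epsilon,\ k=0,\dots,N-1\}$. Worst case error: for $F=(a,x)\in\mathcal P_d$, $\rho^x_\epsilon(F)=\sup_{F'=(a',x')\in E_\epsilon(F)}\|x'-x\|\in[0,\infty]$, where $\|\cdot\|$ is the Euclidean norm on $\mathbb R^d$ (the space of nodes). Cluster: $F\in\mathcal P_d$ forms an $(i,h,M)$-cluster ($0<h<1$,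 $M>0$, $1\le i\le d-1$) if $x_{i+1}-x_i=h$ and $|a_i|,|a_{i+1}|\le M$. *)

theory Defs
  imports "HOL-Analysis.Analysis"
begin

text \<open>
  A spike-train signal is a pair \<open>(a, x)\<close> of an amplitude vector and a node vector. Vectors in
  $\mathbb{R}^d$ are functions on the index set \<open>{1..d}\<close>, extended by \<open>undefined\<close> outside of it
  (so that each vector has exactly one representative). An index type of class \<open>finite\<close> is not
  used because the nodes are ordered and neighbouring indices matter.
\<close>

type_synonym signal = "(nat \<Rightarrow> real) \<times> (nat \<Rightarrow> real)"

definition signals :: "nat \<Rightarrow> signal set" where
  "signals d = {(a, x). a \<in> {1..d} \<rightarrow>\<^sub>E UNIV \<and> x \<in> {1..d} \<rightarrow>\<^sub>E UNIV \<and> strict_mono_on {1..d} x}"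

definition moment :: "nat \<Rightarrow> signal \<Rightarrow> nat \<Rightarrow> real" where
  "moment d F k = (\<Sum>j=1..d. fst F j * snd F j ^ k)"

definition error_set :: "nat \<Rightarrow> nat \<Rightarrow> real \<Rightarrow> signal \<Rightarrow> signal set" where
  "error_set d N \<epsilon> F = {F' \<in> signals d. \<forall>k<N. \<bar>moment d F' k - moment d F k\<bar> \<le> \<epsilon>}"

text \<open>The supremum may be infinite, hence the type \<^typ>\<open>ennreal\<close>.\<close>

definition worst_node_error :: "nat \<Rightarrow> nat \<Rightarrow> real \<Rightarrow> signal \<Rightarrow> ennreal" where
  "worst_node_error d N \<epsilon> F =
     (SUP F' \<in> error_set d N \<epsilon> F. ennreal (L2_set (\<lambda>j. snd F' j - snd F j) {1..d}))"

definition forms_cluster :: "nat \<Rightarrow> signal \<Rightarrow> nat \<Rightarrow> real \<Rightarrow> real \<Rightarrow> bool" where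
  "forms_cluster d F i h M \<longleftrightarrow>
     F \<in> signals d \<and> 0 < h \<and> h < 1 \<and> 0 < M \<and> 1 \<le> i \<and> i \<le> d - 1 \<and>
     snd F (i + 1) - snd F i = h \<and> \<bar>fst F i\<bar> \<le> M \<and> \<bar>fst F (i + 1)\<bar> \<le> M"

end

theory Submission
  imports Defs
begin

text \<open>
  In the coordinate \<open>(t - \<kappa>) / h\<close> the cluster carries masses \<open>p\<close>, \<open>q\<close> at \<open>-1/2\<close>, \<open>1/2\<close>.
  Two nodes \<open>u\<close>, \<open>v\<close> carry amplitudes with the same moments of order 0, 1, 2 iff the cluster
  annihilates \<open>(t - u) * (t - v)\<close>. Moving the node with the smaller amplitude away from \<open>\<kappa>\<close> to
  distance 1 determines the other node, which then stays in \<open>[-1, -1/4]\<close> or \<open>[1/4, 1]\<close>. The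
  difference of the two signals annihilates quadratic polynomials and lives within distance \<open>h\<close>
  of \<open>\<kappa>\<close>, so expanding its moments around \<open>\<kappa>\<close> leaves only terms with a factor \<open>h ^ 3\<close>.
\<close>

text \<open>In the binomial expansion of each power around \<open>\<kappa>\<close>, the terms of
  degree \<open>l\<close> in \<open>h\<close> add up to a multiple of the \<open>l\<close>-th moment
  of the weights \<open>c\<close> at the points \<open>y\<close>. Since all
  \<open>\<bar>y j\<bar> \<le> 1\<close>, every such moment is at most the total mass.\<close>

lemma sum_powers_cancellation:
  fixes c y :: "'i \<Rightarrow> real"
  assumes "0 \<le> h" and "h \<le> 1" and y: "\<And>j. j \<in> J \<Longrightarrow> \<bar>y j\<bar> \<le> 1"
    and ann: "\<And>l. l < n \<Longrightarrow> (\<Sum>j\<in>J. c j * y j ^ l) = 0"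
  shows "\<bar>\<Sum>j\<in>J. c j * (\<kappa> + h * y j) ^ k\<bar> \<le> (\<Sum>j\<in>J. \<bar>c j\<bar>) * (1 + \<bar>\<kappa>\<bar>) ^ k * h ^ n"
proof -
  define m where "m l = (\<Sum>j\<in>J. c j * y j ^ l)" for l
  have m_bound: "\<bar>m l\<bar> \<le> (\<Sum>j\<in>J. \<bar>c j\<bar>)" for l
    unfolding m_def
    by (intro order.trans[OF sum_abs] sum_mono)
      (auto simp: abs_mult power_abs intro!: mult_left_le power_le_one y)
  \<comment> \<open>A bound independent of \<open>l\<close>, so that the binomial sum below
    collapses to \<open>(1 + \<bar>\<kappa>\<bar>) ^ k\<close>.\<close>
  have hm: "\<bar>h ^ l * m l\<bar> \<le> h ^ n * (\<Sum>j\<in>J. \<bar>c j\<bar>)" for l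
  proof (cases "l < n")
    case True
    then show ?thesis using ann assms(1) by (simp add: m_def sum_nonneg)
  next
    case False
    then have "h ^ l \<le> h ^ n" using assms by (intro power_decreasing) auto
    then show ?thesis using assms(1) m_bound[of l] by (auto simp: abs_mult intro!: mult_mono)
  qed
  have "(\<Sum>j\<in>J. c j * (\<kappa> + h * y j) ^ k)
      = (\<Sum>j\<in>J. \<Sum>l\<le>k. of_nat (k choose l) * \<kappa> ^ (k - l) * (h ^ l * (c j * y j ^ l)))"
    by (simp add: add.commute[of \<kappa>] binomial_ring sum_distrib_left power_mult_distrib mult_ac)
  also have "\<dots> = (\<Sum>l\<le>k. of_nat (k choose l) * \<kappa> ^ (k - l) * (h ^ l * m l))"
    by (subst sum.swap) (simp add: m_def sum_distrib_left)
  also have "\<bar>\<dots>\<bar> \<le> (\<Sum>l\<le>k. of_nat (k choose l) * \<bar>\<kappa>\<bar> ^ (k - l) * (h ^ n * (\<Sum>j\<in>J. \<bar>c j\<bar>)))"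
    by (intro order.trans[OF sum_abs] sum_mono)
      (simp add: abs_mult[of "_ * _ ^ _"] abs_mult[of "of_nat _"] power_abs hm mult_left_mono)
  also have "\<dots> = (1 + \<bar>\<kappa>\<bar>) ^ k * (h ^ n * (\<Sum>j\<in>J. \<bar>c j\<bar>))"
    by (simp add: binomial_ring[of 1] sum_distrib_right)
  finally show ?thesis by (simp add: mult_ac)
qed

text \<open>The right-hand sides are the moments of masses \<open>p\<close> at -1/2 and
  \<open>q\<close> at 1/2; the new nodes are \<open>u\<close> and 1. The condition
  \<open>\<bar>q\<bar> \<le> \<bar>p\<bar>\<close> keeps \<open>3 * p + q\<close> away from 0 for
  nonzero \<open>p\<close>, which makes the equation for \<open>u\<close> solvable.\<close>

lemma two_spikes_same_moments_aux:
  fixes p q :: real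
  assumes "\<bar>p\<bar> \<le> M" and "\<bar>q\<bar> \<le> \<bar>p\<bar>"
  obtains b c u where "-1 \<le> u" "u < 1" "b + c = p + q" "b * u + c = (q - p) / 2"
    "b * u\<^sup>2 + c = (p + q) / 4" "\<bar>b\<bar> \<le> 2 * M" "\<bar>c\<bar> \<le> M"
proof (cases "p = 0")
  case True
  \<comment> \<open>Here \<open>q\<close> vanishes too, so zero amplitudes match all three
    moments.\<close>
  then show thesis using assms that[of 0 0 0] by auto
next
  case False
  \<comment> \<open>The equations are homogeneous in the masses, so scaling by \<open>p\<close>
    leaves one parameter in [-1, 1].\<close>
  define r where "r = q / p"
  have r: "-1 \<le> r" "r \<le> 1"
    using assms False by (auto simp: r_def divide_simps abs_if split: if_splits)
  have q: "q = p * r" using False by (simp add: r_def)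
  \<comment> \<open>Annihilation of \<open>(t - u) * (t - 1)\<close> by masses 1 and
    \<open>r\<close> reads \<open>3 * (1/2 + u) = r * (1/2 - u)\<close>, which gives
    \<open>u\<close>. The moments of order 0 and 1 then determine \<open>b\<close> and
    \<open>c\<close>.\<close>
  define u where "u = - ((3 - r) / (2 * (3 + r)))"
  define b where "b = (r + 3)\<^sup>2 / (9 + r)"
  define c where "c = 4 * r / (9 + r)"
  have "(r + 3)\<^sup>2 \<le> 2 * (9 + r)"
    using mult_nonneg_nonneg[of "1 - r" "1 + r"] r by (simp add: power2_eq_square algebra_simps)
  then have bb: "\<bar>b\<bar> \<le> 2" and cc: "\<bar>c\<bar> \<le> 1"
    using r by (auto simp: b_def c_def divide_simps abs_if)
  have nz: "9 + r \<noteq> 0" "3 + r \<noteq> 0" using r by auto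
  show thesis
  proof (rule that[of u "p * b" "p * c"])
    show "-1 \<le> u" "u < 1" using r by (auto simp: u_def divide_simps)
    have "b + c = 1 + r" using nz
      by (simp add: b_def c_def divide_simps) (simp add: power2_eq_square algebra_simps)
    then show "p * b + p * c = p + q" by (simp add: q flip: distrib_left) (simp add: distrib_left)
    have "b * u + c = (r - 1) / 2" using nz
      by (simp add: b_def c_def u_def divide_simps) (simp add: power2_eq_square algebra_simps)
    then have "p * (b * u + c) = p * ((r - 1) / 2)" by simp
    then show "p * b * u + p * c = (q - p) / 2" by (simp add: q algebra_simps diff_divide_distrib)
    \<comment> \<open>The factor \<open>(r + 3)\<^sup>2\<close> in \<open>b\<close> cancels the
      denominator of \<open>u\<^sup>2\<close>.\<close>
    have "(r + 3) * u = - ((3 - r) / 2)" using nz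
      by (simp add: u_def divide_simps) (simp add: algebra_simps)
    moreover have "b * u\<^sup>2 = ((r + 3) * u)\<^sup>2 / (9 + r)"
      by (simp add: b_def power_mult_distrib)
    ultimately have "b * u\<^sup>2 = (3 - r)\<^sup>2 / (4 * (9 + r))"
      by (simp add: power_divide)
    then have "b * u\<^sup>2 + c = (1 + r) / 4" using nz
      by (simp add: c_def divide_simps) (simp add: power2_eq_square algebra_simps)
    then have "p * (b * u\<^sup>2 + c) = p * ((1 + r) / 4)" by simp
    then show "p * b * u\<^sup>2 + p * c = (p + q) / 4" by (simp add: q algebra_simps add_divide_distrib)
    show "\<bar>p * b\<bar> \<le> 2 * M" using mult_mono[OF bb assms(1)] by (simp add: abs_mult mult.commute)
    show "\<bar>p * c\<bar> \<le> M" using mult_mono[OF cc assms(1)] by (simp add: abs_mult mult.commute)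
  qed
qed

text \<open>The reflection \<open>t \<mapsto> -t\<close> exchanges \<open>p\<close> and
  \<open>q\<close>, so the larger mass may be assumed to sit on the left. The alternative
  \<open>u = -1 \<or> v = 1\<close> records which node has moved by exactly 1/2.\<close>

lemma two_spikes_same_moments:
  fixes p q :: real
  assumes "\<bar>p\<bar> \<le> M" and "\<bar>q\<bar> \<le> M"
  obtains b c u v where "-1 \<le> u" "u < v" "v \<le> 1" "u = -1 \<or> v = 1" "b + c = p + q"
    "b * u + c * v = (q - p) / 2" "b * u\<^sup>2 + c * v\<^sup>2 = (p + q) / 4" "\<bar>b\<bar> + \<bar>c\<bar> \<le> 3 * M"
proof (cases "\<bar>q\<bar> \<le> \<bar>p\<bar>")
  case True
  from two_spikes_same_moments_aux[OF assms(1) this] obtain b c u where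
    "-1 \<le> u" "u < 1" "b + c = p + q" "b * u + c = (q - p) / 2"
    "b * u\<^sup>2 + c = (p + q) / 4" "\<bar>b\<bar> \<le> 2 * M" "\<bar>c\<bar> \<le> M" .
  then show thesis by (intro that[of u 1 b c]) auto
next
  case False
  then have "\<bar>p\<bar> \<le> \<bar>q\<bar>" by simp
  from two_spikes_same_moments_aux[OF assms(2) this] obtain b c u where
    "-1 \<le> u" "u < 1" "b + c = q + p" "b * u + c = (p - q) / 2"
    "b * u\<^sup>2 + c = (q + p) / 4" "\<bar>b\<bar> \<le> 2 * M" "\<bar>c\<bar> \<le> M" .
  then show thesis by (intro that[of "-1" "-u" c b]) (auto simp: field_simps)
qed

lemma moment_update_two:
  assumes "1 \<le> i" and "i < d"
  shows "moment d (a(i := b, i + 1 := c), x(i := s, i + 1 := t)) k - moment d (a, x) k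
    = b * s ^ k + c * t ^ k - a i * x i ^ k - a (i + 1) * x (i + 1) ^ k"
proof -
  have sub: "{i, i + 1} \<subseteq> {1..d}" using assms by auto
  have *: "moment d F k = fst F i * snd F i ^ k + fst F (i + 1) * snd F (i + 1) ^ k
      + (\<Sum>j\<in>{1..d} - {i, i + 1}. fst F j * snd F j ^ k)" for F
    unfolding moment_def by (subst sum.subset_diff[OF sub]) auto
  have "(\<Sum>j\<in>{1..d} - {i, i + 1}. (a(i := b, i + 1 := c)) j * (x(i := s, i + 1 := t)) j ^ k)
      = (\<Sum>j\<in>{1..d} - {i, i + 1}. a j * x j ^ k)"
    by (rule sum.cong) auto
  then show ?thesis by (simp add: *)
qed

text \<open>By monotonicity of \<open>x\<close>, the nodes adjacent to the pair separate it from all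
  the others.\<close>

lemma strict_mono_on_update_two:
  fixes x :: "nat \<Rightarrow> real"
  assumes mono: "strict_mono_on {1..d} x" and i: "1 \<le> i" "i < d" and "s < t"
    and left: "i \<ge> 2 \<Longrightarrow> x (i - 1) < s" and right: "i \<le> d - 2 \<Longrightarrow> t < x (i + 2)"
  shows "strict_mono_on {1..d} (x(i := s, i + 1 := t))"
proof (rule strict_mono_onI)
  fix j k assume jk: "j \<in> {1..d}" "k \<in> {1..d}" "j < k"
  have xjk: "x j < x k" using strict_mono_onD[OF mono jk] .
  have L: "x l < s" if "l \<in> {1..d}" "l < i" for l
  proof -
    have "x l \<le> x (i - 1)"
      using mono that i by (intro strict_mono_on_leD[OF mono]) auto
    then show ?thesis using left that by auto
  qed
  have R: "t < x l" if "l \<in> {1..d}" "i + 1 < l" for l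
  proof -
    have "x (i + 2) \<le> x l"
      using mono that i by (intro strict_mono_on_leD[OF mono]) auto
    moreover have "i \<le> d - 2" using that by auto
    ultimately show ?thesis using right by linarith
  qed
  consider "j < i" | "j = i" | "j = i + 1" | "i + 1 < j" by linarith
  then show "(x(i := s, i + 1 := t)) j < (x(i := s, i + 1 := t)) k"
  proof cases
    case 1
    then show ?thesis using xjk L[of j] jk \<open>s < t\<close> by auto
  next
    case 2
    then show ?thesis using R[of k] jk \<open>s < t\<close> by (cases "k = i + 1") auto
  next
    case 3
    then show ?thesis using R[of k] jk by auto
  next
    case 4
    then show ?thesis using xjk jk by auto
  qed
qed

theorem theorem4p2:
  fixes d N i :: nat and h M :: real and a x :: "nat \<Rightarrow> real"
  assumes "d \<ge> 2" and "N \<ge> 2 * d" and "1 \<le> i" and "i \<le> d - 1"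
    and "0 < h" and "h < 1" and "M > 0"
    and "(a, x) \<in> signals d"
    and "forms_cluster d (a, x) i h M"
    and "i \<ge> 2 \<Longrightarrow> x i - x (i - 1) \<ge> 3 * h"
    and "i \<le> d - 2 \<Longrightarrow> x (i + 2) - x (i + 1) \<ge> 3 * h"
  shows "let \<kappa> = (x i + x (i + 1)) / 2;
             C = 18 * M * (1 + \<bar>\<kappa>\<bar>) ^ N
         in \<forall>\<epsilon>. \<epsilon> \<ge> C * h ^ 3 \<longrightarrow> worst_node_error d N \<epsilon> (a, x) \<ge> ennreal (h / 2)"
proof -
  define \<kappa> where "\<kappa> = (x i + x (i + 1)) / 2"
  have id: "i < d" using assms by auto
  have gap: "x (i + 1) - x i = h" and aM: "\<bar>a i\<bar> \<le> M" "\<bar>a (i + 1)\<bar> \<le> M"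
    using assms(9) by (auto simp: forms_cluster_def)
  have xi: "x i = \<kappa> + h * (-1/2)" and xi1: "x (i + 1) = \<kappa> + h * (1/2)"
    using gap unfolding \<kappa>_def by (auto simp: field_simps)
  obtain b c u v where uv: "-1 \<le> u" "u < v" "v \<le> 1" "u = -1 \<or> v = 1"
    and m0: "b + c = a i + a (i + 1)" and m1: "b * u + c * v = (a (i + 1) - a i) / 2"
    and m2: "b * u\<^sup>2 + c * v\<^sup>2 = (a i + a (i + 1)) / 4" and bc: "\<bar>b\<bar> + \<bar>c\<bar> \<le> 3 * M"
    by (rule two_spikes_same_moments[OF aM])
  define s where "s = \<kappa> + h * u"
  define t where "t = \<kappa> + h * v"
  define a' where "a' = a(i := b, i + 1 := c)"
  define x' where "x' = x(i := s, i + 1 := t)"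
  have "h * (-1) \<le> h * u" "h * v \<le> h * 1" "h * u < h * v"
    using uv \<open>0 < h\<close> by (simp_all only: mult_le_cancel_left_pos mult_less_cancel_left_pos)
  then have st: "\<kappa> - h \<le> s" "t \<le> \<kappa> + h" "s < t" by (auto simp: s_def t_def)
  \<comment> \<open>The new nodes stay within \<open>h\<close> of \<open>\<kappa>\<close>, while any
    neighbouring node is at least \<open>7 * h / 2\<close> away from it.\<close>
  have "strict_mono_on {1..d} x'" unfolding x'_def
    using assms(8,10,11) st xi xi1 \<open>0 < h\<close> \<open>1 \<le> i\<close> id
    by (intro strict_mono_on_update_two) (auto simp: signals_def)
  then have sig: "(a', x') \<in> signals d"
    using assms(8) \<open>1 \<le> i\<close> id by (auto simp: signals_def a'_def x'_def PiE_iff extensional_def)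
  have moments: "\<bar>moment d (a', x') k - moment d (a, x) k\<bar> \<le> 18 * M * (1 + \<bar>\<kappa>\<bar>) ^ N * h ^ 3"
    if "k < N" for k
  proof -
    \<comment> \<open>The difference of the two signals as four point masses \<open>w\<close> at the
      rescaled positions \<open>y\<close>: the new pair minus the old one.\<close>
    define w where "w = [b, c, - a i, - a (i + 1)]"
    define y where "y = [u, v, -1/2, 1/2 :: real]"
    have sum4: "(\<Sum>j<4. f j) = f 0 + f 1 + f 2 + f 3" for f :: "nat \<Rightarrow> real"
      by (simp add: eval_nat_numeral)
    have "(\<Sum>j<4. w ! j * y ! j ^ l) = 0" if "l < 3" for l
    proof -
      have "l = 0 \<or> l = 1 \<or> l = 2" using that by auto
      then show ?thesis using m0 m1 m2
        by (auto simp: sum4 w_def y_def power2_eq_square eval_nat_numeral)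
    qed
    moreover have "\<bar>y ! j\<bar> \<le> 1" if "j < 4" for j
      using that uv by (auto simp: y_def less_Suc_eq eval_nat_numeral)
    ultimately have "\<bar>\<Sum>j<4. w ! j * (\<kappa> + h * y ! j) ^ k\<bar>
        \<le> (\<Sum>j<4. \<bar>w ! j\<bar>) * (1 + \<bar>\<kappa>\<bar>) ^ k * h ^ 3"
      using assms by (intro sum_powers_cancellation) auto
    moreover have "(\<Sum>j<4. w ! j * (\<kappa> + h * y ! j) ^ k)
        = moment d (a', x') k - moment d (a, x) k"
      unfolding a'_def x'_def moment_update_two[OF \<open>1 \<le> i\<close> id] unfolding xi xi1 sum4
      by (simp add: w_def y_def s_def t_def eval_nat_numeral)
    moreover have "(\<Sum>j<4. \<bar>w ! j\<bar>) * (1 + \<bar>\<kappa>\<bar>) ^ k * h ^ 3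
        \<le> 18 * M * (1 + \<bar>\<kappa>\<bar>) ^ N * h ^ 3"
    proof (intro mult_mono)
      \<comment> \<open>The new amplitudes contribute at most \<open>3 * M\<close> and the old ones
        at most \<open>2 * M\<close>.\<close>
      show "(\<Sum>j<4. \<bar>w ! j\<bar>) \<le> 18 * M"
        using bc aM \<open>M > 0\<close> by (simp add: sum4 w_def eval_nat_numeral)
      show "(1 + \<bar>\<kappa>\<bar>) ^ k \<le> (1 + \<bar>\<kappa>\<bar>) ^ N"
        using that by (intro power_increasing) auto
    qed (use \<open>0 < h\<close> \<open>M > 0\<close> in auto)
    ultimately show ?thesis by linarith
  qed
  have "h / 2 \<le> L2_set (\<lambda>j. x' j - x j) {1..d}"
  proof -
    have "\<bar>x' j - x j\<bar> \<le> L2_set (\<lambda>j. x' j - x j) {1..d}" if "j \<in> {1..d}" for j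
      \<comment> \<open>Passing to absolute values leaves the norm unchanged and turns the
        coordinate bound into a two-sided one.\<close>
      using member_le_L2_set[of "{1..d}" j "\<lambda>j. \<bar>x' j - x j\<bar>"] that by (simp add: L2_set_def)
    \<comment> \<open>If \<open>u = -1\<close>, node \<open>i\<close> moves from
      \<open>\<kappa> - h / 2\<close> to \<open>\<kappa> - h\<close>; if \<open>v = 1\<close>, node
      \<open>i + 1\<close> moves from \<open>\<kappa> + h / 2\<close> to
      \<open>\<kappa> + h\<close>.\<close>
    from this[of i] this[of "i + 1"] show ?thesis
      using uv(4) \<open>1 \<le> i\<close> id xi xi1 by (auto simp: x'_def s_def t_def)
  qed
  then have "ennreal (h / 2) \<le> worst_node_error d N \<epsilon> (a, x)"
    if "\<epsilon> \<ge> 18 * M * (1 + \<bar>\<kappa>\<bar>) ^ N * h ^ 3" for \<epsilon>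
    unfolding worst_node_error_def
    using sig order.trans[OF moments that]
    by (intro SUP_upper2[of "(a', x')"]) (auto simp: error_set_def intro: ennreal_leI)
  then show ?thesis by (simp add: Let_def \<kappa>_def)
qed

end
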